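(* Let $\alpha>0$ and $0<\gamma<\frac12$. Then there exists a non-negative function $q\in L^1_{loc}(\mathbb{R})$, satisfying $\int_x^{x+a}q(y)\,dy\to0$ as $|x|\to\infty$ for every fixed $a>0$, such that $$A_\gamma(q)=\infty,\qquad B_\gamma(q)=\infty,\qquad \|q^*_{\alpha,\mu}\|_{L^{\frac12+\gamma}(\mathbb{R})}<\infty,$$ where $\mu$ is the measure given by $\mu(A)=\int_Aq(x)\,dx$ for Borel $A\subset\mathbb{R}$.
   Context: For a non-negative Radon measure $\mu$ on $\mathbb{R}$ and $\alpha>0$, the Otelbaev function is $$q^*_{\alpha,\mu}(x)=\inf\left\{\tfrac1{d^2}:\ d>0,\ \mu\left(\left[x-\tfrac d2,x+\tfrac d2\right]\right)<\tfrac1{\alpha d}\right\}.$$ For $0<\gamma<\frac12$ put $\sigma=\frac{1/2-\gamma}{1/2+\gamma}$, $\mathcal{F}_0=[-1,1]$, $\mathcal{F}_k=[-2^k,-2^{k-1}]\cup[2^{k-1},2^k]$ for $k=1,2,\dots$, and for non-negative $q\in L^1_{loc}(\mathbb{R})$ define (with values in $[0,\infty]$) $$A_\gamma(q)=\sum_{k=0}^\infty\left(\int_{\mathcal{F}_k}(1+|x|)^\sigma q(x)dx\right)^{\frac12+\gamma}+\left(\sum_{k=0}^\infty\left(\int_{\mathcal{F}_k}(1+|x|)^\sigma q(x)dx\right)^{\frac12+\gamma}\right)^{\frac{2\gamma}{\frac12+\gamma}},$$ $$B_\gamma(q)=\sum_{k=0}^\infty\left(\int_k^{k+1}q(x)dx\right)^{2\gamma}+\sum_{k=0}^\infty\left(\int_k^{k+1}q(x)dx\right)^{\frac12+\gamma}.$$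 Here $\|f\|_{L^r(\mathbb{R})}=(\int|f|^r)^{1/r}$ also for $0<r<1$. *)

theory Defs
  imports "HOL-Analysis.Analysis"
begin

text \<open>
  Real powers on \<open>[0,\<infinity>]\<close>.  Only exponents \<open>r > 0\<close> are used, so \<open>\<infinity>\<close> is sent to \<open>\<infinity>\<close>; and
  \<open>0 powr r = 0\<close> agrees with the usual convention.
\<close>

definition ennpowr :: "ennreal \<Rightarrow> real \<Rightarrow> ennreal" where
  "ennpowr x r = (if x = \<infinity> then \<infinity> else ennreal (enn2real x powr r))"

definition Lnorm :: "real \<Rightarrow> (real \<Rightarrow> ennreal) \<Rightarrow> ennreal" where
  "Lnorm r f = ennpowr (\<integral>\<^sup>+ x. ennpowr (f x) r \<partial>lborel) (1 / r)"

definition locally_integrable :: "(real \<Rightarrow> real) \<Rightarrow> bool" where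
  "locally_integrable q \<longleftrightarrow> (\<forall>K. compact K \<longrightarrow> set_integrable lborel K q)"

definition otelbaev :: "real \<Rightarrow> real measure \<Rightarrow> real \<Rightarrow> ennreal" where
  "otelbaev \<alpha> M x =
     Inf {ennreal (1 / d\<^sup>2) | d. d > 0 \<and> emeasure M {x - d / 2 .. x + d / 2} < ennreal (1 / (\<alpha> * d))}"

fun dyadic_shell :: "nat \<Rightarrow> real set" where
  "dyadic_shell 0 = {-1..1}"
| "dyadic_shell (Suc k) = {- (2 ^ Suc k) .. - (2 ^ k)} \<union> {2 ^ k .. 2 ^ Suc k}"

definition sigma_exp :: "real \<Rightarrow> real" where
  "sigma_exp \<gamma> = (1 / 2 - \<gamma>) / (1 / 2 + \<gamma>)"

definition shell_sum :: "real \<Rightarrow> (real \<Rightarrow> real) \<Rightarrow> ennreal" where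
  "shell_sum \<gamma> q =
     (\<Sum>k. ennpowr (\<integral>\<^sup>+x\<in>dyadic_shell k. ennreal ((1 + \<bar>x\<bar>) powr sigma_exp \<gamma> * q x) \<partial>lborel)
              (1 / 2 + \<gamma>))"

definition A_func :: "real \<Rightarrow> (real \<Rightarrow> real) \<Rightarrow> ennreal" where
  "A_func \<gamma> q = shell_sum \<gamma> q + ennpowr (shell_sum \<gamma> q) (2 * \<gamma> / (1 / 2 + \<gamma>))"

definition B_func :: "real \<Rightarrow> (real \<Rightarrow> real) \<Rightarrow> ennreal" where
  "B_func \<gamma> q =
     (\<Sum>k::nat. ennpowr (\<integral>\<^sup>+x\<in>{real k .. real k + 1}. ennreal (q x) \<partial>lborel) (2 * \<gamma>)) +
     (\<Sum>k::nat. ennpowr (\<integral>\<^sup>+x\<in>{real k .. real k + 1}. ennreal (q x) \<partial>lborel) (1 / 2 + \<gamma>))"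

text \<open>
  The Otelbaev function of a Radon measure is upper semicontinuous, hence Borel; so the
  \<open>nn_integral\<close> in \<^const>\<open>Lnorm\<close>, which is a lower integral on non-measurable functions, is a genuine
  Lebesgue integral when applied to it.
\<close>

lemma otelbaev_borel_measurable:
  assumes sets: "sets M = sets borel"
    and fin: "\<And>K. compact K \<Longrightarrow> emeasure M K < \<infinity>"
  shows "otelbaev \<alpha> M \<in> borel_measurable borel"
proof (rule borel_measurableI_less)
  fix t :: ennreal
  have op: "open {x. emeasure M {x - d / 2 .. x + d / 2} < c}" (is "open ?S")
    for d :: real and c :: ennreal
    unfolding open_dist
  proof
    fix x assume x: "x \<in> ?S"
    define I where "I n = {x - d / 2 - 1 / Suc n .. x + d / 2 + 1 / Suc n}" for n :: nat
    have dec: "decseq I"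
      unfolding decseq_def I_def
    proof (intro allI impI)
      fix m n :: nat assume "m \<le> n"
      then have "1 / real (Suc n) \<le> 1 / real (Suc m)"
        by (simp add: frac_le)
      then show "{x - d / 2 - 1 / Suc n .. x + d / 2 + 1 / Suc n}
          \<subseteq> {x - d / 2 - 1 / Suc m .. x + d / 2 + 1 / Suc m}"
        unfolding atLeastatMost_subset_iff by linarith
    qed
    have lim: "(\<lambda>n. a + 1 / real (Suc n)) \<longlonglongrightarrow> a" for a
      using LIMSEQ_inverse_real_of_nat_add[of a] by (simp add: inverse_eq_divide)
    have "(\<Inter>n. I n) = {x - d / 2 .. x + d / 2}"
    proof
      show "(\<Inter>n. I n) \<subseteq> {x - d / 2 .. x + d / 2}"
      proof
        fix y assume "y \<in> (\<Inter>n. I n)"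
        then have "x - d / 2 \<le> y + 1 / real (Suc n)" "y \<le> x + d / 2 + 1 / real (Suc n)" for n
          unfolding I_def INT_iff atLeastAtMost_iff by (smt (verit) UNIV_I)+
        then have "x - d / 2 \<le> y" "y \<le> x + d / 2"
          by (blast intro: LIMSEQ_le_const[OF lim])+
        then show "y \<in> {x - d / 2 .. x + d / 2}" by simp
      qed
    next
      have "{x - d / 2 .. x + d / 2} \<subseteq> I n" for n
      proof -
        have "0 \<le> 1 / real (Suc n)" by simp
        then show ?thesis unfolding I_def atLeastatMost_subset_iff by linarith
      qed
      then show "{x - d / 2 .. x + d / 2} \<subseteq> (\<Inter>n. I n)" by blast
    qed
    moreover have "(INF n. emeasure M (I n)) = emeasure M (\<Inter>n. I n)"
    proof (rule INF_emeasure_decseq)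
      show "range I \<subseteq> sets M" by (auto simp: sets I_def)
      show "emeasure M (I n) \<noteq> \<infinity>" for n
        using fin[of "I n"] by (auto simp: I_def)
    qed (fact dec)
    ultimately have "(INF n. emeasure M (I n)) < c"
      using x by simp
    then obtain n where n: "emeasure M (I n) < c"
      unfolding INF_less_iff by blast
    show "\<exists>e>0. \<forall>y. dist y x < e \<longrightarrow> y \<in> ?S"
    proof (intro exI[of _ "1 / real (Suc n)"] conjI allI impI)
      fix y assume "dist y x < 1 / real (Suc n)"
      then have "{y - d / 2 .. y + d / 2} \<subseteq> I n"
        unfolding I_def dist_real_def atLeastatMost_subset_iff by linarith
      then have "emeasure M {y - d / 2 .. y + d / 2} \<le> emeasure M (I n)"
        by (intro emeasure_mono) (auto simp: sets I_def)
      with n show "y \<in> ?S" by auto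
    qed simp
  qed
  have "{x \<in> space borel. otelbaev \<alpha> M x < t} =
      (\<Union>d\<in>{d. d > 0 \<and> ennreal (1 / d\<^sup>2) < t}.
         {x. emeasure M {x - d / 2 .. x + d / 2} < ennreal (1 / (\<alpha> * d))})"
    unfolding otelbaev_def Inf_less_iff by auto
  moreover have "open \<dots>"
    by (intro open_UN ballI op)
  ultimately show "{x \<in> space borel. otelbaev \<alpha> M x < t} \<in> sets borel"
    by simp
qed

end

theory Submission
  imports Defs
begin

text \<open>
  The potential is a sum of very distant plateaus, the \<open>n\<close>-th of length \<open>N n\<close> and height
  \<open>1 / (N n)\<^sup>2\<close>, so of mass \<open>1 / N n\<close>.  At the scale \<open>N n\<close> that its mass dictates for the
  Otelbaev function, such a plateau is indistinguishable from a point mass: it contributes only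
  about \<open>(N n) powr - (2 * \<gamma>)\<close> to the integral of the \<open>(1/2 + \<gamma>)\<close>-th power.
  In \<open>B_func\<close> it is seen as \<open>N n\<close> separate unit cells, contributing
  \<open>(N n) powr (1 - 4 * \<gamma>)\<close>, which is much more.  Moving the plateaus further out makes the weight
  in \<open>A_func\<close> as large as desired without affecting the rest.
\<close>

section \<open>Preliminaries: extended powers, divergent series, integrals over the line\<close>

lemma ennpowr_mono:
  assumes "x \<le> y" "0 \<le> r"
  shows "ennpowr x r \<le> ennpowr y r"
proof (cases "y = \<infinity>")
  case False
  then have "x \<noteq> \<infinity>" using assms by (auto simp: top_unique)
  moreover have "enn2real x \<le> enn2real y"
    using assms False by (intro enn2real_mono) (auto simp: less_top)
  ultimately show ?thesis
    using False assms by (auto simp: ennpowr_def intro!: ennreal_leI powr_mono2)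
qed (simp add: ennpowr_def)

lemma ennpowr_ennreal: "0 \<le> a \<Longrightarrow> ennpowr (ennreal a) r = ennreal (a powr r)"
  by (simp add: ennpowr_def)

lemma ennpowr_less_top: "x < \<infinity> \<Longrightarrow> ennpowr x r < \<infinity>"
  by (auto simp: ennpowr_def)

text \<open>The lower bounds may come from arbitrary finite index sets, because the divergence
  proofs below collect terms over blocks of unit cells and over scattered dyadic shells rather than
  over initial segments.\<close>

lemma ennreal_suminf_eq_top:
  fixes f :: "nat \<Rightarrow> ennreal"
  assumes "\<And>m. \<exists>F. finite F \<and> ennreal (b m) \<le> sum f F"
    and "filterlim b at_top sequentially"
  shows "suminf f = \<infinity>"
proof -
  have "ennreal r \<le> suminf f" for r
  proof -
    obtain m where "r \<le> b m"
      using assms(2) unfolding filterlim_at_top eventually_sequentially by blast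
    moreover obtain F where "finite F" "ennreal (b m) \<le> sum f F"
      using assms(1) by blast
    moreover have "sum f F \<le> suminf f"
      using \<open>finite F\<close> by (intro sum_le_suminf) auto
    ultimately show ?thesis
      by (meson ennreal_leI order_trans)
  qed
  then show ?thesis
    by (metis ennreal_enn2real ennreal_le_iff enn2real_nonneg infinity_ennreal_def
        less_add_one linorder_not_le less_top add_nonneg_nonneg zero_le_one)
qed

text \<open>The right half line is computed with an explicit antiderivative and the left one follows
  by reflection. The two halves share the point 0, so their sum is used only as an upper
  bound.\<close>

lemma nn_integral_one_plus_abs_powr_finite:
  fixes r :: real
  assumes "1 < r"
  shows "(\<integral>\<^sup>+ t. ennreal ((1 + \<bar>t\<bar>) powr - r) \<partial>lborel) < \<infinity>"
proof -
  let ?f = "\<lambda>t::real. ennreal ((1 + \<bar>t\<bar>) powr - r)"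
  let ?F = "\<lambda>t::real. (1 + t) powr (1 - r) / (1 - r)"
  have half: "(\<integral>\<^sup>+ t. ?f t * indicator {0..} t \<partial>lborel) < \<infinity>"
  proof -
    have "(\<integral>\<^sup>+ t. ?f t * indicator {0..} t \<partial>lborel)
        = (\<integral>\<^sup>+ t. ennreal ((1 + t) powr - r) * indicator {0..} t \<partial>lborel)"
      by (intro nn_integral_cong) (auto simp: indicator_def)
    also have "\<dots> = ennreal (0 - ?F 0)"
    proof (rule nn_integral_FTC_atLeast)
      show "DERIV ?F t :> (1 + t) powr - r" if "0 \<le> t" for t
        using that assms by (auto intro!: derivative_eq_intros)
      have "((\<lambda>t. (1 + t) powr (1 - r)) \<longlongrightarrow> 0) at_top"
        using assms
        by (intro tendsto_neg_powr filterlim_tendsto_add_at_top[OF tendsto_const] filterlim_ident)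
          auto
      then show "(?F \<longlongrightarrow> 0) at_top"
        by (simp add: tendsto_divide_zero)
    qed auto
    finally show ?thesis by simp
  qed
  have "(\<integral>\<^sup>+ t. ?f t * indicator {..0} t \<partial>lborel)
      = (\<integral>\<^sup>+ t. ?f t * indicator {0..} t \<partial>lborel)"
    by (subst nn_integral_real_affine[where c = "-1" and t = 0])
      (auto intro!: nn_integral_cong simp: indicator_def)
  moreover have "(\<integral>\<^sup>+ t. ?f t \<partial>lborel)
      \<le> (\<integral>\<^sup>+ t. ?f t * indicator {0..} t + ?f t * indicator {..0} t \<partial>lborel)"
    by (intro nn_integral_mono) (auto simp: indicator_def)
  moreover have "\<dots> = (\<integral>\<^sup>+ t. ?f t * indicator {0..} t \<partial>lborel)
      + (\<integral>\<^sup>+ t. ?f t * indicator {..0} t \<partial>lborel)"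
    by (intro nn_integral_add) auto
  ultimately show ?thesis
    using half by (auto simp: less_top intro: le_less_trans)
qed

text \<open>The substitution \<open>x = a + b * t\<close> extracts all dependence on
  \<open>b\<close>. With \<open>r = 1 + 2 * \<gamma>\<close> and \<open>b = N n\<close> the
  prefactor becomes \<open>(N n) powr - (2 * \<gamma>)\<close>, the term of the series whose
  convergence is assumed later.\<close>

lemma nn_integral_abs_plus_powr:
  fixes r a b :: real
  assumes "0 < b"
  shows "(\<integral>\<^sup>+ x. ennreal ((\<bar>x - a\<bar> + b) powr - r) \<partial>lborel)
    = ennreal (b powr (1 - r)) * (\<integral>\<^sup>+ t. ennreal ((1 + \<bar>t\<bar>) powr - r) \<partial>lborel)"
proof -
  have "(\<integral>\<^sup>+ x. ennreal ((\<bar>x - a\<bar> + b) powr - r) \<partial>lborel)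
      = ennreal b * (\<integral>\<^sup>+ t. ennreal ((\<bar>b * t\<bar> + b) powr - r) \<partial>lborel)"
    using assms by (subst nn_integral_real_affine[where c = b and t = a]) auto
  also have "(\<bar>b * t\<bar> + b) powr - r = b powr - r * (1 + \<bar>t\<bar>) powr - r" for t
    using assms by (simp add: powr_mult[symmetric] abs_mult algebra_simps)
  then have "(\<integral>\<^sup>+ t. ennreal ((\<bar>b * t\<bar> + b) powr - r) \<partial>lborel)
      = ennreal (b powr - r) * (\<integral>\<^sup>+ t. ennreal ((1 + \<bar>t\<bar>) powr - r) \<partial>lborel)"
    by (simp add: ennreal_mult nn_integral_cmult)
  also have "ennreal b * \<dots> = ennreal (b powr (1 - r)) * (\<integral>\<^sup>+ t. ennreal ((1 + \<bar>t\<bar>) powr - r) \<partial>lborel)"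
    using assms
    by (simp add: mult.assoc[symmetric] ennreal_mult[symmetric] powr_diff powr_minus field_simps)
  finally show ?thesis .
qed

text \<open>Dominated convergence with majorant \<open>\<bar>f y\<bar>\<close>: a fixed point
  \<open>y\<close> has left the window once \<open>t > \<bar>y\<bar> + \<bar>a\<bar>\<close>. The
  sign \<open>z\<close> treats both ends of the line at once.\<close>

lemma window_integral_tendsto_0:
  fixes f :: "real \<Rightarrow> real"
  assumes "integrable lborel f"
  shows "((\<lambda>x. \<integral>y\<in>{x..x + a}. f y \<partial>lborel) \<longlongrightarrow> 0) at_infinity"
proof -
  have lim: "((\<lambda>t. \<integral>y\<in>{z * t..z * t + a}. f y \<partial>lborel) \<longlongrightarrow> 0) at_top"
    if z: "\<bar>z\<bar> = 1" for z :: real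
  proof -
    have "((\<lambda>t. \<integral>y. indicat_real {z * t..z * t + a} y *\<^sub>R f y \<partial>lborel)
        \<longlongrightarrow> (\<integral>y. 0 \<partial>(lborel :: real measure))) at_top"
    proof (rule integral_dominated_convergence_at_top[where w = "\<lambda>y. \<bar>f y\<bar>"])
      show "AE y in lborel. ((\<lambda>t. indicat_real {z * t..z * t + a} y *\<^sub>R f y) \<longlongrightarrow> 0) at_top"
      proof (rule AE_I2)
        fix y :: real
        have "eventually (\<lambda>t. indicat_real {z * t..z * t + a} y *\<^sub>R f y = 0) at_top"
          using eventually_gt_at_top[of "\<bar>y\<bar> + \<bar>a\<bar>"]
          by eventually_elim (use z in \<open>auto simp: indicator_def abs_if split: if_splits\<close>)
        then show "((\<lambda>t. indicat_real {z * t..z * t + a} y *\<^sub>R f y) \<longlongrightarrow> 0) at_top"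
          by (rule tendsto_eventually)
      qed
    qed (use assms in \<open>auto simp: indicator_def intro!: always_eventually\<close>)
    then show ?thesis
      by (simp add: set_lebesgue_integral_def)
  qed
  show ?thesis
    unfolding at_infinity_eq_at_top_bot
    using lim[of 1] lim[of "-1"] by (auto intro!: filterlim_sup simp: filterlim_at_bot_mirror)
qed

section \<open>The plateau potential and its mass\<close>

locale sparse_plateaus =
  fixes N c :: "nat \<Rightarrow> nat"
  assumes N_pos: "0 < N n"
    and N_mono: "mono N"
    and gap: "n < m \<Longrightarrow> c n + 6 * N m < c m"
    and summable_mass: "summable (\<lambda>n. 1 / real (N n))"
begin

definition plateau :: "nat \<Rightarrow> real set" where
  "plateau n = {real (c n) .. real (c n) + real (N n)}"

text \<open>Working in \<open>ennreal\<close> first allows sum and integral to be exchanged without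
  any convergence argument; the real-valued potential is read off afterwards.\<close>

definition potential_ennreal :: "real \<Rightarrow> ennreal" where
  "potential_ennreal x = (\<Sum>n. ennreal (1 / (real (N n))\<^sup>2) * indicator (plateau n) x)"

definition potential :: "real \<Rightarrow> real" where
  "potential x = enn2real (potential_ennreal x)"

lemma plateau_sets [measurable]: "plateau n \<in> sets borel"
  by (simp add: plateau_def)

lemma potential_ennreal_measurable [measurable]: "potential_ennreal \<in> borel_measurable borel"
  unfolding potential_ennreal_def[abs_def] by measurable

lemma potential_measurable [measurable]: "potential \<in> borel_measurable borel"
  unfolding potential_def[abs_def] by measurable

lemma potential_nonneg: "0 \<le> potential x"
  by (simp add: potential_def)

lemma total_mass_finite: "(\<Sum>n. ennreal (1 / real (N n))) < \<infinity>"
  using summable_mass by (simp add: less_top suminf_ennreal2)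

text \<open>Since \<open>enn2real\<close> sends \<infinity> to 0, finiteness has to be checked. As
  \<open>N n\<close> is at least 1, each height \<open>1 / (N n)\<^sup>2\<close> is at most the mass
  \<open>1 / N n\<close>, and the masses are summable.\<close>

lemma ennreal_potential: "ennreal (potential x) = potential_ennreal x"
proof -
  have "potential_ennreal x \<le> (\<Sum>n. ennreal (1 / real (N n)))"
    unfolding potential_ennreal_def
  proof (intro suminf_le)
    fix n
    have "1 \<le> real (N n)" using N_pos[of n] by linarith
    then have "1 / (real (N n))\<^sup>2 \<le> 1 / real (N n)"
      by (intro frac_le) (auto simp: power2_eq_square)
    then show "ennreal (1 / (real (N n))\<^sup>2) * indicator (plateau n) x \<le> ennreal (1 / real (N n))"
      by (auto simp: indicator_def intro: ennreal_leI)
  qed auto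
  then show ?thesis
    unfolding potential_def using total_mass_finite by (intro ennreal_enn2real) (metis infinity_ennreal_def le_less_trans)
qed

lemma nn_integral_potential:
  assumes [measurable]: "S \<in> sets borel"
  shows "(\<integral>\<^sup>+ x\<in>S. ennreal (potential x) \<partial>lborel)
    = (\<Sum>n. ennreal (1 / (real (N n))\<^sup>2) * emeasure lborel (plateau n \<inter> S))"
proof -
  have "(\<integral>\<^sup>+ x\<in>S. ennreal (potential x) \<partial>lborel)
      = (\<integral>\<^sup>+ x. (\<Sum>n. ennreal (1 / (real (N n))\<^sup>2) * indicator (plateau n \<inter> S) x) \<partial>lborel)"
    unfolding ennreal_potential potential_ennreal_def
    by (intro nn_integral_cong) (auto simp: indicator_def)
  also have "\<dots> = (\<Sum>n. \<integral>\<^sup>+ x. ennreal (1 / (real (N n))\<^sup>2) * indicator (plateau n \<inter> S) x \<partial>lborel)"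
    by (intro nn_integral_suminf) auto
  also have "\<dots> = (\<Sum>n. ennreal (1 / (real (N n))\<^sup>2) * emeasure lborel (plateau n \<inter> S))"
    by (intro suminf_cong nn_integral_cmult_indicator) auto
  finally show ?thesis .
qed

lemma plateau_mass_le:
  assumes "S \<in> sets borel"
  shows "ennreal (1 / (real (N n))\<^sup>2) * emeasure lborel (plateau n \<inter> S) \<le> ennreal (1 / real (N n))"
proof -
  have "emeasure lborel (plateau n \<inter> S) \<le> emeasure lborel (plateau n)"
    using assms by (intro emeasure_mono) auto
  also have "\<dots> = ennreal (real (N n))" by (simp add: plateau_def)
  finally have "ennreal (1 / (real (N n))\<^sup>2) * emeasure lborel (plateau n \<inter> S)
      \<le> ennreal (1 / (real (N n))\<^sup>2) * ennreal (real (N n))"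
    by (intro mult_left_mono) auto
  also have "\<dots> = ennreal (1 / real (N n))"
    using N_pos[of n] by (simp add: ennreal_mult[symmetric] power2_eq_square)
  finally show ?thesis .
qed

lemma integrable_potential: "integrable lborel potential"
proof (rule integrableI_nonneg)
  have "(\<integral>\<^sup>+ x\<in>UNIV. ennreal (potential x) \<partial>lborel) \<le> (\<Sum>n. ennreal (1 / real (N n)))"
    using plateau_mass_le[of UNIV] by (subst nn_integral_potential) (auto intro!: suminf_le)
  then show "(\<integral>\<^sup>+ x. ennreal (potential x) \<partial>lborel) < \<infinity>"
    using total_mass_finite by (simp add: order.strict_trans1)
qed (auto simp: potential_nonneg)

lemma locally_integrable_potential: "locally_integrable potential"
  unfolding locally_integrable_def set_integrable_def
  using integrable_potential by (auto intro!: integrable_mult_indicator borel_compact simp del: real_scaleR_def)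

lemma potential_ge: "x \<in> plateau n \<Longrightarrow> 1 / (real (N n))\<^sup>2 \<le> potential x"
proof -
  assume x: "x \<in> plateau n"
  have "(\<Sum>i\<in>{n}. ennreal (1 / (real (N i))\<^sup>2) * indicator (plateau i) x) \<le> potential_ennreal x"
    unfolding potential_ennreal_def by (intro sum_le_suminf) auto
  with x show ?thesis
    by (simp add: ennreal_potential[symmetric] potential_nonneg)
qed

section \<open>Divergence of the two functionals\<close>

text \<open>The first series of \<open>B_func\<close> already diverges. A plateau has integer
  endpoints, so it consists of exactly \<open>N n\<close> unit cells, each contributing at least
  \<open>(N n) powr (- 4 * \<gamma>)\<close>. The hypothesis \<open>lower\<close> compares the block
  totals with the harmonic series.\<close>

lemma B_func_eq_top:
  assumes "0 < \<gamma>" and lower: "\<And>n. K / real (Suc n) \<le> real (N n) powr (1 - 4 * \<gamma>)" and "0 < K"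
  shows "B_func \<gamma> potential = \<infinity>"
proof -
  let ?f = "\<lambda>k::nat. ennpowr (\<integral>\<^sup>+x\<in>{real k .. real k + 1}. ennreal (potential x) \<partial>lborel) (2 * \<gamma>)"
  define blk where "blk n = {c n ..< c n + N n}" for n
  have "blk i \<inter> blk j = {}" if "i < j" for i j
    \<comment> \<open>Already \<open>c i + N i < c j\<close> suffices: \<open>N i \<le> N j\<close>
      by monotonicity, and \<open>gap\<close> leaves room for six times \<open>N j\<close>.\<close>
    using gap[OF that] N_mono[THEN monoD, of i j] that by (auto simp: blk_def)
  then have disj: "blk i \<inter> blk j = {}" if "i \<noteq> j" for i j
    using that by (metis inf_commute linorder_neqE_nat)
  have f_ge: "ennreal (real (N n) powr (- 4 * \<gamma>)) \<le> ?f k" if "k \<in> blk n" for n k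
  proof -
    have sub: "{real k .. real k + 1} \<subseteq> plateau n"
      using that by (auto simp: blk_def plateau_def)
    have "ennreal (1 / (real (N n))\<^sup>2)
        = (\<integral>\<^sup>+x\<in>{real k .. real k + 1}. ennreal (1 / (real (N n))\<^sup>2) \<partial>lborel)"
      by (simp add: nn_integral_cmult_indicator)
    also have "\<dots> \<le> (\<integral>\<^sup>+x\<in>{real k .. real k + 1}. ennreal (potential x) \<partial>lborel)"
      using sub potential_ge by (intro nn_integral_mono) (auto simp: indicator_def intro!: ennreal_leI)
    finally have "ennpowr (ennreal (1 / (real (N n))\<^sup>2)) (2 * \<gamma>) \<le> ?f k"
      using assms by (intro ennpowr_mono) auto
    moreover have "(1 / (real (N n))\<^sup>2) powr (2 * \<gamma>) = real (N n) powr (- 4 * \<gamma>)"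
    proof -
      have "1 / (real (N n))\<^sup>2 = real (N n) powr (-2)"
        using N_pos[of n] by (simp add: powr_minus powr_realpow divide_inverse)
      then show ?thesis by (simp add: powr_powr)
    qed
    ultimately show ?thesis by (simp add: ennpowr_ennreal)
  qed
  have "suminf ?f = \<infinity>"
  proof (rule ennreal_suminf_eq_top)
    fix m :: nat
    have "ennreal (K * harm m) = ennreal (\<Sum>n<m. K / real (Suc n))"
      by (simp add: harm_altdef sum_distrib_left divide_inverse)
    also have "\<dots> = (\<Sum>n<m. ennreal (K / real (Suc n)))"
      using assms by (intro sum_ennreal[symmetric]) auto
    also have "\<dots> \<le> (\<Sum>n<m. sum ?f (blk n))"
    proof (rule sum_mono)
      fix n
      have "ennreal (K / real (Suc n)) \<le> ennreal (real (N n) powr (1 - 4 * \<gamma>))"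
        by (intro ennreal_leI lower)
      also have "real (N n) powr (1 - 4 * \<gamma>) = real (N n) * real (N n) powr (- 4 * \<gamma>)"
        using N_pos[of n] by (simp add: powr_diff powr_minus divide_inverse)
      also have "ennreal \<dots> = of_nat (card (blk n)) * ennreal (real (N n) powr (- 4 * \<gamma>))"
        by (simp add: blk_def ennreal_mult ennreal_of_nat_eq_real_of_nat)
      also have "\<dots> \<le> sum ?f (blk n)"
        by (rule sum_bounded_below) (rule f_ge)
      finally show "ennreal (K / real (Suc n)) \<le> sum ?f (blk n)" .
    qed
    also have "\<dots> = sum ?f (\<Union>n<m. blk n)"
      by (intro sum.UNION_disjoint[symmetric] ballI impI disj) (simp_all add: blk_def)
    finally show "\<exists>F. finite F \<and> ennreal (K * harm m) \<le> sum ?f F"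
      by (intro exI[of _ "\<Union>n<m. blk n"]) (auto simp: blk_def)
  next
    show "filterlim (\<lambda>m. K * harm m) at_top sequentially"
      using \<open>0 < K\<close> harm_at_top by (intro filterlim_tendsto_pos_mult_at_top[OF tendsto_const])
  qed
  then show ?thesis by (simp add: B_func_def)
qed

text \<open>Starting at a power of two and having length at most \<open>c n\<close>, a plateau lies
  inside a single dyadic shell. There the weight is at least \<open>N n\<close> by
  \<open>large\<close>, which cancels the mass \<open>1 / N n\<close>. So infinitely many shells
  contribute at least 1 each.\<close>

lemma A_func_eq_top:
  assumes "0 < \<gamma>" "\<gamma> < 1 / 2" and "strict_mono k" and c: "\<And>n. c n = 2 ^ k n"
    and N_le: "\<And>n. N n \<le> c n"
    and large: "\<And>n. real (N n) \<le> real (c n) powr sigma_exp \<gamma>"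
  shows "A_func \<gamma> potential = \<infinity>"
proof -
  let ?s = "sigma_exp \<gamma>"
  have s: "0 < ?s" using assms by (simp add: sigma_exp_def)
  let ?g = "\<lambda>j. \<integral>\<^sup>+x\<in>dyadic_shell j. ennreal ((1 + \<bar>x\<bar>) powr ?s * potential x) \<partial>lborel"
  let ?f = "\<lambda>j. ennpowr (?g j) (1 / 2 + \<gamma>)"
  have f_ge: "1 \<le> ?f (Suc (k n))" for n
  proof -
    have sub: "plateau n \<subseteq> dyadic_shell (Suc (k n))"
    proof -
      have "real (N n) \<le> 2 ^ k n" using N_le[of n] unfolding c
        by (metis of_nat_le_iff of_nat_numeral of_nat_power)
      then show ?thesis unfolding plateau_def c dyadic_shell.simps by (intro le_supI2) auto
    qed
    have Np: "0 < real (N n)" using N_pos[of n] by simp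
    have "1 = ennreal (1 / real (N n)) * ennreal (real (N n))"
      using Np by (simp add: ennreal_mult[symmetric])
    also have "\<dots> = (\<integral>\<^sup>+x\<in>plateau n. ennreal (1 / real (N n)) \<partial>lborel)"
      by (simp add: nn_integral_cmult_indicator) (simp add: plateau_def)
    also have "\<dots> \<le> ?g (Suc (k n))"
    proof (intro nn_integral_mono)
      fix x :: real
      show "ennreal (1 / real (N n)) * indicator (plateau n) x
          \<le> ennreal ((1 + \<bar>x\<bar>) powr ?s * potential x) * indicator (dyadic_shell (Suc (k n))) x"
      proof (cases "x \<in> plateau n")
        case True
        have "1 / real (N n) = real (N n) * (1 / (real (N n))\<^sup>2)"
          using Np by (simp add: power2_eq_square)
        also have "\<dots> \<le> real (c n) powr ?s * potential x"
          using True by (intro mult_mono large potential_ge) auto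
        also have "\<dots> \<le> (1 + \<bar>x\<bar>) powr ?s * potential x"
          using True s by (intro mult_right_mono powr_mono2 potential_nonneg) (auto simp: plateau_def)
        finally show ?thesis
          using True sub by (auto simp: indicator_def simp del: dyadic_shell.simps intro!: ennreal_leI)
      qed simp
    qed
    finally have "ennpowr (ennreal 1) (1 / 2 + \<gamma>) \<le> ?f (Suc (k n))"
      using assms by (intro ennpowr_mono) auto
    then show ?thesis by (subst (asm) ennpowr_ennreal) auto
  qed
  have "suminf ?f = \<infinity>"
  proof (rule ennreal_suminf_eq_top)
    fix m :: nat
    have inj: "inj_on (\<lambda>n. Suc (k n)) {..<m}"
      using \<open>strict_mono k\<close> by (auto simp: inj_on_def strict_mono_eq)
    have "ennreal (real m) = (\<Sum>n<m. 1)"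
      by (simp add: ennreal_of_nat_eq_real_of_nat)
    also have "\<dots> \<le> (\<Sum>n<m. ?f (Suc (k n)))"
      by (intro sum_mono f_ge)
    also have "\<dots> = sum ?f ((\<lambda>n. Suc (k n)) ` {..<m})"
      using inj by (simp add: sum.reindex del: dyadic_shell.simps)
    finally show "\<exists>F. finite F \<and> ennreal (real m) \<le> sum ?f F"
      by blast
  next
    show "filterlim real at_top sequentially" by (rule filterlim_real_sequentially)
  qed
  then have "shell_sum \<gamma> potential = \<infinity>" by (simp add: shell_sum_def)
  then show ?thesis by (simp add: A_func_def)
qed

section \<open>The Otelbaev function of the potential\<close>

text \<open>For a point mass \<open>1 / N n\<close> at \<open>c n\<close>, a window around
  \<open>x\<close> is admissible if it misses the point or is shorter than
  \<open>N n / \<alpha>\<close>. The largest admissible length is thus comparable to the maximum of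
  distance and \<open>N n\<close>, hence to this sum.\<close>

definition spread :: "nat \<Rightarrow> real \<Rightarrow> real" where
  "spread n x = \<bar>x - real (c n)\<bar> + real (N n)"

lemma spread_pos: "0 < spread n x"
  using N_pos[of n] by (simp add: spread_def add_nonneg_pos)

text \<open>The factor 2 avoids having to show that the infimum is attained. It gives strict room
  because the infimum is at least 1.\<close>

lemma ex_spread_almost_minimal: "\<exists>n. \<forall>m. spread n x \<le> 2 * spread m x"
proof -
  let ?D = "INF m. spread m x"
  have "1 \<le> spread m x" for m using N_pos[of m] by (simp add: spread_def)
  then have bdd: "bdd_below (range (\<lambda>m. spread m x))" and "1 \<le> ?D"
    by (auto intro!: bdd_belowI2 cINF_greatest)
  then have "?D < 2 * ?D" by simp
  then obtain n where "spread n x < 2 * ?D"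
    by (subst (asm) cINF_less_iff[OF _ bdd]) auto
  moreover have "?D \<le> spread m x" for m by (intro cINF_lower bdd) auto
  ultimately show ?thesis by (intro exI[of _ n]) (smt (verit))
qed

text \<open>
  A window of length \<open>d\<close>, a small multiple of the least \<open>spread\<close>, meets at most one plateau, and
  only one with \<open>N m\<close> at least a large multiple of \<open>d\<close>, hence of mass \<open>1 / N m\<close> below \<open>1 / (\<alpha> d)\<close>.
\<close>

lemma ex_otelbaev_le:
  assumes "0 < \<alpha>"
  shows "\<exists>n. otelbaev \<alpha> (density lborel (\<lambda>x. ennreal (potential x))) x
    \<le> ennreal ((2 * (1 + 4 * \<alpha>))\<^sup>2 / (spread n x)\<^sup>2)"
proof -
  obtain n where n: "\<And>m. spread n x \<le> 2 * spread m x"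
    using ex_spread_almost_minimal by blast
  \<comment> \<open>Chosen so that \<open>4 * e * \<alpha> < 1\<close>, which later turns
    \<open>d \<le> 4 * e * N m\<close> into \<open>1 / N m < 1 / (\<alpha> * d)\<close>. The factor
    1/2 in \<open>d\<close> below absorbs the 2 of almost-minimality.\<close>
  define e where "e = 1 / (1 + 4 * \<alpha>)"
  have e: "0 < e" "e \<le> 1" "4 * e * \<alpha> < 1"
    using assms by (auto simp: e_def field_simps)
  define d where "d = e / 2 * spread n x"
  have d: "0 < d" using e spread_pos by (simp add: d_def)
  have d_le: "d \<le> e * spread m x" for m
    using n[of m] e by (simp add: d_def)
  let ?W = "{x - d / 2 .. x + d / 2}"
  \<comment> \<open>If the window touches plateau \<open>m\<close>, then \<open>spread m x\<close>
    is at most \<open>2 * N m + d / 2\<close>. Inserting this into \<open>d_le\<close> and absorbing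
    \<open>e * (d / 2)\<close> on the left, by \<open>e \<le> 1\<close>, bounds \<open>d\<close> by
    a multiple of \<open>N m\<close>.\<close>
  have meets: "\<bar>x - real (c m)\<bar> \<le> real (N m) + d / 2 \<and> d \<le> 4 * e * real (N m)"
    if "plateau m \<inter> ?W \<noteq> {}" for m
  proof -
    have 1: "\<bar>x - real (c m)\<bar> \<le> real (N m) + d / 2"
      using that by (auto simp: plateau_def abs_le_iff)
    have "d \<le> e * (2 * real (N m) + d / 2)"
      using d_le[of m] mult_left_mono[OF 1, of e] e by (simp add: spread_def algebra_simps)
    moreover have "e * (d / 2) \<le> d / 2"
      using e d by (simp add: mult_le_cancel_right1)
    ultimately have "d \<le> 4 * e * real (N m)" by (simp add: algebra_simps)
    with 1 show ?thesis by blast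
  qed
  \<comment> \<open>Source of the 6 in \<open>gap\<close>: touching both plateaus would give
    \<open>c j - c i \<le> N i + N j + d\<close>, and \<open>d \<le> 4 * N i\<close>, so the
    distance would be at most \<open>6 * N j\<close>.\<close>
  have unique: False
    if "i < j" and i: "plateau i \<inter> ?W \<noteq> {}" and j: "plateau j \<inter> ?W \<noteq> {}" for i j
  proof -
    have "real (N i) \<le> real (N j)" using N_mono[THEN monoD, of i j] that by simp
    moreover have "real (c i) + 6 * real (N j) < real (c j)"
      using gap[OF \<open>i < j\<close>] by linarith
    moreover have "e * real (N i) \<le> real (N i)" using e by (simp add: mult_left_le_one_le)
    ultimately show False using meets[OF i] meets[OF j] by (simp add: abs_le_iff)
  qed
  have "emeasure (density lborel (\<lambda>x. ennreal (potential x))) ?W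
      = (\<Sum>m. ennreal (1 / (real (N m))\<^sup>2) * emeasure lborel (plateau m \<inter> ?W))"
    by (subst emeasure_density) (auto simp: nn_integral_potential)
  also have "\<dots> < ennreal (1 / (\<alpha> * d))"
  proof (cases "\<exists>m. plateau m \<inter> ?W \<noteq> {}")
    case True
    then obtain m where m: "plateau m \<inter> ?W \<noteq> {}" by blast
    then have "plateau j \<inter> ?W = {}" if "j \<noteq> m" for j
      using unique that by (metis linorder_neqE_nat)
    then have "(\<Sum>m. ennreal (1 / (real (N m))\<^sup>2) * emeasure lborel (plateau m \<inter> ?W))
        = ennreal (1 / (real (N m))\<^sup>2) * emeasure lborel (plateau m \<inter> ?W)"
      by (subst suminf_finite[where N = "{m}"]) auto
    also have "\<dots> \<le> ennreal (1 / real (N m))" by (intro plateau_mass_le) auto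
    also have "\<dots> < ennreal (1 / (\<alpha> * d))"
    proof (intro ennreal_lessI)
      have "\<alpha> * d \<le> \<alpha> * (4 * e * real (N m))"
        using meets[OF m] assms by (intro mult_left_mono) auto
      also have "\<dots> < real (N m)"
        using e N_pos[of m] mult_strict_right_mono[of "4 * e * \<alpha>" 1 "real (N m)"]
        by (simp add: mult_ac)
      finally show "1 / real (N m) < 1 / (\<alpha> * d)"
        using assms d N_pos[of m] by (intro divide_strict_left_mono) auto
    qed (use assms d in auto)
    finally show ?thesis .
  next
    case False
    then show ?thesis using assms d by auto
  qed
  finally have "otelbaev \<alpha> (density lborel (\<lambda>x. ennreal (potential x))) x \<le> ennreal (1 / d\<^sup>2)"
    unfolding otelbaev_def using d by (intro Inf_lower) auto
  also have "1 / d\<^sup>2 = (2 * (1 + 4 * \<alpha>))\<^sup>2 / (spread n x)\<^sup>2"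
    by (simp add: d_def e_def power_divide power_mult_distrib)
  finally show ?thesis by blast
qed

text \<open>The index in the pointwise bound depends on \<open>x\<close>. Replacing the single term
  by the sum over all indices removes this dependence, and termwise integration with the scaling
  identity leaves a constant times the series in \<open>summ\<close>.\<close>

lemma Lnorm_otelbaev_finite:
  assumes "0 < \<alpha>" "0 < \<gamma>" and summ: "summable (\<lambda>n. real (N n) powr - (2 * \<gamma>))"
  shows "Lnorm (1 / 2 + \<gamma>) (otelbaev \<alpha> (density lborel (\<lambda>x. ennreal (potential x)))) < \<infinity>"
proof -
  let ?p = "1 / 2 + \<gamma>" and ?r = "1 + 2 * \<gamma>"
  let ?q = "otelbaev \<alpha> (density lborel (\<lambda>x. ennreal (potential x)))"
  let ?I = "\<integral>\<^sup>+ t. ennreal ((1 + \<bar>t\<bar>) powr - ?r) \<partial>lborel"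
  define K where "K = (2 * (1 + 4 * \<alpha>)) powr ?r"
  have "(\<integral>\<^sup>+ x. ennpowr (?q x) ?p \<partial>lborel)
      \<le> (\<integral>\<^sup>+ x. (\<Sum>n. ennreal K * ennreal (spread n x powr - ?r)) \<partial>lborel)"
  proof (intro nn_integral_mono)
    fix x
    obtain n where n: "?q x \<le> ennreal ((2 * (1 + 4 * \<alpha>))\<^sup>2 / (spread n x)\<^sup>2)"
      using ex_otelbaev_le assms by blast
    have sq: "(y\<^sup>2) powr ?p = y powr ?r" if "0 < y" for y :: real
    proof -
      have "y\<^sup>2 = y powr 2" using that by simp
      then show ?thesis by (simp only: powr_powr) (simp add: algebra_simps)
    qed
    have "ennpowr (?q x) ?p \<le> ennpowr (ennreal ((2 * (1 + 4 * \<alpha>))\<^sup>2 / (spread n x)\<^sup>2)) ?p"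
      using n assms by (intro ennpowr_mono) auto
    also have "\<dots> = ennreal K * ennreal (spread n x powr - ?r)"
    proof -
      have "((2 * (1 + 4 * \<alpha>))\<^sup>2 / (spread n x)\<^sup>2) powr ?p = K * spread n x powr - ?r"
        using assms spread_pos[of n x] unfolding K_def powr_minus_divide
        by (simp add: powr_divide sq)
      then show ?thesis by (subst ennpowr_ennreal) (auto simp: ennreal_mult K_def)
    qed
    also have "\<dots> = (\<Sum>i\<in>{n}. ennreal K * ennreal (spread i x powr - ?r))" by simp
    also have "\<dots> \<le> (\<Sum>i. ennreal K * ennreal (spread i x powr - ?r))"
      by (intro sum_le_suminf) auto
    finally show "ennpowr (?q x) ?p \<le> (\<Sum>i. ennreal K * ennreal (spread i x powr - ?r))" .
  qed
  also have "\<dots> = (\<Sum>n. \<integral>\<^sup>+ x. ennreal K * ennreal (spread n x powr - ?r) \<partial>lborel)"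
    by (intro nn_integral_suminf) (auto simp: spread_def)
  also have "\<dots> = (\<Sum>n. ennreal (real (N n) powr - (2 * \<gamma>)) * (ennreal K * ?I))"
  proof (intro suminf_cong)
    fix n
    have "(\<integral>\<^sup>+ x. ennreal K * ennreal (spread n x powr - ?r) \<partial>lborel)
        = ennreal K * (\<integral>\<^sup>+ x. ennreal (spread n x powr - ?r) \<partial>lborel)"
      by (intro nn_integral_cmult) (auto simp: spread_def)
    also have "\<dots> = ennreal K * (ennreal (real (N n) powr (1 - ?r)) * ?I)"
      using N_pos[of n] unfolding spread_def by (subst nn_integral_abs_plus_powr) auto
    finally show "(\<integral>\<^sup>+ x. ennreal K * ennreal (spread n x powr - ?r) \<partial>lborel)
        = ennreal (real (N n) powr - (2 * \<gamma>)) * (ennreal K * ?I)"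
      by (simp add: mult_ac)
  qed
  also have "\<dots> = (\<Sum>n. ennreal (real (N n) powr - (2 * \<gamma>))) * (ennreal K * ?I)"
    by (rule ennreal_suminf_multc)
  also have "\<dots> < \<infinity>"
    using summ nn_integral_one_plus_abs_powr_finite[of ?r] assms
    by (simp add: suminf_ennreal2 ennreal_mult_less_top)
  finally show ?thesis
    unfolding Lnorm_def by (rule ennpowr_less_top)
qed

end

section \<open>Choice of lengths and positions\<close>

theorem propositionA10:
  fixes \<alpha> \<gamma> :: real
  assumes "\<alpha> > 0" and "0 < \<gamma>" and "\<gamma> < 1 / 2"
  shows "\<exists>q :: real \<Rightarrow> real.
    (\<forall>x. q x \<ge> 0) \<and> locally_integrable q \<and>
    (\<forall>a>0. ((\<lambda>x. \<integral>y\<in>{x..x + a}. q y \<partial>lborel) \<longlongrightarrow> 0) at_infinity) \<and>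
    A_func \<gamma> q = \<infinity> \<and> B_func \<gamma> q = \<infinity> \<and>
    Lnorm (1 / 2 + \<gamma>) (otelbaev \<alpha> (density lborel (\<lambda>x. ennreal (q x)))) < \<infinity>"
proof -
  text \<open>
    The growth exponent \<open>s\<close> of \<open>N\<close> must make \<open>(N n) powr - (2 * \<gamma>)\<close> summable but not
    \<open>(N n) powr (1 - 4 * \<gamma>)\<close>; \<open>1 / (4 \<gamma>\<^sup>2)\<close> does, since
    \<open>4 \<gamma> - 1 \<le> 4 \<gamma>\<^sup>2 < 2 \<gamma>\<close>.
  \<close>
  define s where "s = 1 / (4 * \<gamma>\<^sup>2)"
  define N where "N n = nat \<lceil>real (Suc n) powr s\<rceil>" for n
  \<comment> \<open>\<open>L n\<close> bounds \<open>(N n) powr (1 / sigma_exp \<gamma>)\<close>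
    from above, so \<open>c n \<ge> L n\<close> makes the weight at least
    \<open>N n\<close>.\<close>
  define L where "L n = nat \<lceil>real (N n) powr (1 / sigma_exp \<gamma>)\<rceil>" for n
  \<comment> \<open>Each summand has one task, realised through \<open>k n < 2 ^ k n\<close>:
    \<open>n\<close> makes \<open>k\<close> strictly increasing, \<open>12 * N n\<close> yields the
    gap and \<open>N n \<le> c n\<close>, and \<open>L n\<close> handles the weight.\<close>
  define k where "k n = n + 12 * N n + L n" for n
  define c :: "nat \<Rightarrow> nat" where "c n = 2 ^ k n" for n
  have s: "0 < s" using assms by (simp add: s_def)
  have sig: "0 < sigma_exp \<gamma>" using assms by (simp add: sigma_exp_def)
  have base: "1 \<le> real (Suc n) powr s" for n
    using s by (intro ge_one_powr_ge_zero) auto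
  have N_ge: "real (Suc n) powr s \<le> real (N n)" for n
    unfolding N_def by (rule real_nat_ceiling_ge)
  have N_le: "real (N n) \<le> 2 * real (Suc n) powr s" for n
    using base[of n] unfolding N_def by linarith
  have N_ge1: "1 \<le> real (N n)" for n
    using N_ge[of n] base[of n] by linarith
  have N_mono: "mono N"
    unfolding N_def using s by (intro monoI nat_mono ceiling_mono powr_mono2) auto
  have L_mono: "mono L"
    unfolding L_def using sig N_mono by (intro monoI nat_mono ceiling_mono powr_mono2) (auto dest: monoD)
  have k_mono: "strict_mono k"
    unfolding k_def using N_mono L_mono
    by (intro strict_monoI) (simp add: mono_def add_less_le_mono add_mono less_imp_le)
  have k_less: "k n < c n" for n
    unfolding c_def by (rule less_exp)
  have summable_N: "summable (\<lambda>n. real (N n) powr - (2 * \<gamma>))"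
  proof (rule summable_comparison_test')
    have "1 < 1 / (2 * \<gamma>)" using assms by (simp add: field_simps)
    then have "summable (\<lambda>n. real n powr - (1 / (2 * \<gamma>)))"
      by (subst summable_real_powr_iff) auto
    then show "summable (\<lambda>n. real (Suc n) powr - (1 / (2 * \<gamma>)))"
      by (subst summable_Suc_iff)
    fix n :: nat
    have "real (N n) powr - (2 * \<gamma>) \<le> (real (Suc n) powr s) powr - (2 * \<gamma>)"
      using assms N_ge[of n] base[of n] by (intro powr_mono2') auto
    also have "\<dots> = real (Suc n) powr - (1 / (2 * \<gamma>))"
      using assms by (simp add: powr_powr s_def power2_eq_square)
    finally show "norm (real (N n) powr - (2 * \<gamma>)) \<le> real (Suc n) powr - (1 / (2 * \<gamma>))"
      by simp
  qed
  interpret sparse_plateaus N c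
  proof
    show "0 < N n" for n using N_ge1[of n] by simp
    show "mono N" by fact
    \<comment> \<open>Half of \<open>c m\<close> covers \<open>c n\<close>, by doubling, and the
      other half exceeds \<open>6 * N m\<close>.\<close>
    show "c n + 6 * N m < c m" if "n < m" for n m
    proof -
      have "2 * c n \<le> c m"
        using power_increasing[of "Suc (k n)" "k m" "2::nat"] strict_monoD[OF k_mono that]
        by (simp add: c_def)
      moreover have "12 * N m < c m" using k_less[of m] by (simp add: k_def)
      ultimately show ?thesis by linarith
    qed
    \<comment> \<open>Since \<open>2 * \<gamma> < 1\<close> and \<open>N n \<ge> 1\<close>, the
      masses are dominated by the series already shown to converge.\<close>
    show "summable (\<lambda>n. 1 / real (N n))"
    proof (rule summable_comparison_test'[OF summable_N])
      fix n :: nat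
      have "real (N n) powr - 1 \<le> real (N n) powr - (2 * \<gamma>)"
        using assms N_ge1[of n] by (intro powr_mono) auto
      then show "norm (1 / real (N n)) \<le> real (N n) powr - (2 * \<gamma>)"
        using N_ge1[of n] by (simp add: powr_minus_divide)
    qed
  qed
  have "A_func \<gamma> potential = \<infinity>"
  proof (rule A_func_eq_top[OF assms(2,3) k_mono])
    fix n
    show "c n = 2 ^ k n" by (simp add: c_def)
    show "N n \<le> c n" using k_less[of n] by (simp add: k_def)
    have "real (N n) powr (1 / sigma_exp \<gamma>) \<le> real (L n)"
      unfolding L_def by (rule real_nat_ceiling_ge)
    also have "\<dots> \<le> real (c n)" using k_less[of n] by (simp add: k_def)
    finally have "(real (N n) powr (1 / sigma_exp \<gamma>)) powr sigma_exp \<gamma> \<le> real (c n) powr sigma_exp \<gamma>"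
      using sig by (intro powr_mono2) auto
    then show "real (N n) \<le> real (c n) powr sigma_exp \<gamma>"
      using sig by (simp add: powr_powr)
  qed
  moreover have "B_func \<gamma> potential = \<infinity>"
  \<comment> \<open>The constant is the price of rounding: \<open>N n\<close> may be twice
    \<open>(Suc n) powr s\<close>. Apart from it, \<open>s * (4 * \<gamma>\<^sup>2) = 1\<close>
    produces exactly the harmonic terms.\<close>
  proof (rule B_func_eq_top[where K = "2 powr - (4 * \<gamma>\<^sup>2)"])
    fix n
    have "4 * \<gamma> - 1 \<le> 4 * \<gamma>\<^sup>2"
      using zero_le_power2[of "2 * \<gamma> - 1"] by (simp add: power2_eq_square algebra_simps)
    then have "real (N n) powr - (4 * \<gamma>\<^sup>2) \<le> real (N n) powr (1 - 4 * \<gamma>)"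
      using N_ge1[of n] by (intro powr_mono) auto
    moreover have "(2 * real (Suc n) powr s) powr - (4 * \<gamma>\<^sup>2) \<le> real (N n) powr - (4 * \<gamma>\<^sup>2)"
      using N_le[of n] N_ge1[of n] by (intro powr_mono2') auto
    moreover have "(2 * real (Suc n) powr s) powr - (4 * \<gamma>\<^sup>2) = 2 powr - (4 * \<gamma>\<^sup>2) / real (Suc n)"
    proof -
      have "s * - (4 * \<gamma>\<^sup>2) = -1" using assms by (simp add: s_def)
      then show ?thesis
        by (simp only: powr_mult powr_powr) (simp add: powr_minus_divide)
    qed
    ultimately show "2 powr - (4 * \<gamma>\<^sup>2) / real (Suc n) \<le> real (N n) powr (1 - 4 * \<gamma>)"
      by linarith
  qed (use assms in auto)
  ultimately show ?thesis
    using potential_nonneg locally_integrable_potential window_integral_tendsto_0[OF integrable_potential]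
      Lnorm_otelbaev_finite[OF assms(1,2) summable_N] by blast
qed

end
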